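(* Let $E \subseteq \mathbb{N}^2$. For $u,v>0$ let \[E \cap \lfloor \ell_{(u,v)} \rfloor := \{\, y \in \mathbb{R} \;:\; \text{there is } x \text{ with } (x,y) \in E \text{ and } y = \lfloor ux+v \rfloor \,\}.\] Let $U$ be the set of parameters $(u,v)$ with $u>0$, $v>0$ such that \[\overline{D}\big(E \cap \lfloor \ell_{(u,v)} \rfloor\big) \leq \max\big(0, \overline{D}(E) - 1\big).\] Then $\displaystyle \lim_{M\to\infty} \frac{|U \cap [0,M]^2|}{M^2} = 1$, where $|\cdot|$ denotes two-dimensional Lebesgue measure.
   Context: For $F \subseteq \mathbb{N}^2$ (or more generally a $1$-separated subset of the closed first quadrant of $\mathbb{R}^2$), the mass dimension is $\overline{D}(F) = \limsup_{l \to \infty} \frac{\log |F \cap [0,l]^2|}{\log l}$. For $F \subseteq \mathbb{N}$ (or a subset of $\mathbb{R}$ contained in $\mathbb{N}$), the mass dimension is $\overline{D}(F) = \limsup_{N\to\infty} \frac{\log |F \cap \{1,\dots,N\}|}{\log N}$. Here $|\cdot|$ applied to a discrete set denotes its cardinality, and $\log 0 = -\infty$. Note that $E \cap \lfloor \ell_{(u,v)} \rfloor$ is a set of $y$-values: several points of $E$ with the same $y$ contribute only once. *)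

theory Defs
  imports "HOL-Analysis.Analysis"
begin

definition log_card :: "'a set \<Rightarrow> ereal" where
  "log_card A = (if card A = 0 then -\<infinity> else ereal (ln (real (card A))))"

text \<open>
  The library's \<open>card\<close> sends infinite sets to \<open>0\<close>. The definition below is meant for
  1-separated subsets of the closed first quadrant, for which every set
  \<open>F \<inter> [0,l]\<^sup>2\<close> is finite.
\<close>

definition mass_dim2 :: "(real \<times> real) set \<Rightarrow> ereal" where
  "mass_dim2 F = Limsup at_top (\<lambda>l::real. log_card (F \<inter> {0..l} \<times> {0..l}) / ereal (ln l))"

definition mass_dim1 :: "real set \<Rightarrow> ereal" where
  "mass_dim1 F = limsup (\<lambda>N::nat. log_card (F \<inter> real ` {1..N}) / ereal (ln (real N)))"

definition line_slice :: "(real \<times> real) set \<Rightarrow> real \<Rightarrow> real \<Rightarrow> real set" where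
  "line_slice E u v = {y. \<exists>x. (x, y) \<in> E \<and> y = real_of_int \<lfloor>u * x + v\<rfloor>}"

end

(* In fact almost every (u, v) in the first quadrant lies in U. Fix a > 0 with
   dim E < 1 + a and restrict (u, v) to [1/m, m] x [0, m]. Points (x, y) of E on the
   discretised line with y in [2^k, 2^(k+1)) have x comparable to 2^k, and the parameters
   whose line passes through (x, y) form a strip of measure at most m / x. So the expected
   number of such points is of order 2^(k (dim E - 1)), and weighting the k-th block by
   2^(-k a) gives a series with finite integral, which is finite almost everywhere. *)
theory Submission
  imports Defs
begin

section \<open>Counting bounds and mass dimension\<close>

lemma mass_dim1_le_powr:
  assumes "C > 0" "\<And>N::nat. N \<ge> 1 \<Longrightarrow> real (card (B \<inter> real ` {1..N})) \<le> C * real N powr a"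
  shows "mass_dim1 B \<le> ereal a"
proof -
  have "mass_dim1 B \<le> limsup (\<lambda>N::nat. ereal (a + ln C / ln (real N)))"
    unfolding mass_dim1_def
  proof (rule Limsup_mono, rule eventually_mono[OF eventually_ge_at_top[of 2]])
    fix N :: nat assume N: "2 \<le> N"
    let ?A = "B \<inter> real ` {1..N}"
    have l: "ln (real N) > 0" using N by simp
    show "log_card ?A / ereal (ln (real N)) \<le> ereal (a + ln C / ln (real N))"
    proof (cases "card ?A = 0")
      case True
      then show ?thesis using l by (simp add: log_card_def)
    next
      case False
      have "ln (real (card ?A)) \<le> ln (C * real N powr a)"
        using False assms(2)[of N] N by (intro ln_mono) (simp_all add: card_gt_0_iff)
      also have "\<dots> = ln C + a * ln (real N)"
        using N \<open>C > 0\<close> by (simp add: ln_mult ln_powr)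
      finally show ?thesis
        using False l by (simp add: log_card_def field_simps)
    qed
  qed
  also have "(\<lambda>N::nat. ereal (a + ln C / ln (real N))) \<longlonglongrightarrow> ereal (a + 0)"
  proof -
    have "(\<lambda>N::nat. ln C / ln (real N)) \<longlonglongrightarrow> 0"
      by (intro tendsto_divide_0[OF tendsto_const] filterlim_at_top_imp_at_infinity
          filterlim_compose[OF ln_at_top filterlim_real_sequentially])
    then show ?thesis by (intro tendsto_intros) auto
  qed
  then have "limsup (\<lambda>N::nat. ereal (a + ln C / ln (real N))) = ereal a"
    by (intro lim_imp_Limsup) auto
  finally show ?thesis by simp
qed

text \<open>Since \<open>2 powr a > 1\<close>, a geometric sum over dyadic blocks is comparable to
  its last term, so block counts give a bound of order \<open>N powr a\<close> for all
  \<open>N\<close>. The finitely many blocks before \<open>K\<close> only affect the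
  constant.\<close>

lemma mass_dim1_le_dyadic:
  assumes "a > 0"
    and bd: "\<And>k. k \<ge> K \<Longrightarrow> real (card (B \<inter> real ` {2^k..<2^(k+1)})) \<le> S * (2 powr a) ^ k"
  shows "mass_dim1 B \<le> ereal a"
proof -
  define r :: real where "r = 2 powr a"
  have r: "r > 1" using \<open>a > 0\<close> unfolding r_def by simp
  \<comment> \<open>A block with \<open>k < K\<close> has at most \<open>2^k\<close> points, hence
    at most \<open>2^K\<close>; taking the maximum covers these blocks too.\<close>
  define T where "T = max S (2^K)"
  have T: "T \<ge> 1" unfolding T_def by (simp add: le_max_iff_disj)
  have bd': "real (card (B \<inter> real ` {2^k..<2^(k+1)})) \<le> T * r ^ k" for k
  proof (cases "k \<ge> K")
    case True
    then have "real (card (B \<inter> real ` {2^k..<2^(k+1)})) \<le> S * r ^ k"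
      using bd by (simp add: r_def)
    also have "\<dots> \<le> T * r ^ k" using r by (intro mult_right_mono) (auto simp: T_def)
    finally show ?thesis .
  next
    case False
    have "card (B \<inter> real ` {2^k..<2^(k+1)}) \<le> card (real ` {2^k..<2^(k+1)::nat})"
      by (intro card_mono) auto
    also have "\<dots> \<le> 2^k" by (rule order_trans[OF card_image_le]) auto
    finally have "real (card (B \<inter> real ` {2^k..<2^(k+1)})) \<le> 2^k"
      by (metis of_nat_le_iff of_nat_numeral of_nat_power)
    also have "(2::real)^k \<le> 2^K" using False by (intro power_increasing) auto
    also have "\<dots> \<le> T * 1" by (simp add: T_def)
    also have "\<dots> \<le> T * r ^ k" using r T by (intro mult_left_mono one_le_power) auto
    finally show ?thesis .
  qed
  \<comment> \<open>The form \<open>r ^ n / (r - 1)\<close> closes the induction exactly: adding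
    \<open>r ^ n\<close> gives \<open>r ^ Suc n / (r - 1)\<close>.\<close>
  have sum: "real (card (B \<inter> real ` {1..<2^n})) \<le> T * (r ^ n / (r - 1))" for n
  proof (induction n)
    case 0
    then show ?case using r T by simp
  next
    case (Suc n)
    have "{1..<2^Suc n} = {1..<2^n} \<union> {2^n..<2^(n+1)::nat}"
      by (auto simp: less_imp_le_nat[OF le_less_trans[OF _ less_exp]] intro: order_trans[rotated])
    then have "B \<inter> real ` {1..<2^Suc n} = (B \<inter> real ` {1..<2^n}) \<union> (B \<inter> real ` {2^n..<2^(n+1)})"
      by (simp only: image_Un Int_Un_distrib)
    then have "card (B \<inter> real ` {1..<2^Suc n}) \<le>
        card (B \<inter> real ` {1..<2^n}) + card (B \<inter> real ` {2^n..<2^(n+1)})"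
      by (simp only: card_Un_le)
    then have "real (card (B \<inter> real ` {1..<2^Suc n})) \<le> T * (r ^ n / (r - 1)) + T * r ^ n"
      using Suc.IH bd'[of n] by linarith
    also have "\<dots> = T * (r ^ Suc n / (r - 1))"
      using r by (simp add: field_simps)
    finally show ?case .
  qed
  show ?thesis
  proof (rule mass_dim1_le_powr)
    show "T * (r / (r - 1)) > 0" using T r by simp
    fix N :: nat assume N: "N \<ge> 1"
    obtain q where q: "2^q \<le> N" "N < 2^(q+1)"
      using ex_power_ivl1[of 2 N] N by auto
    have "card (B \<inter> real ` {1..N}) \<le> card (B \<inter> real ` {1..<2^(q+1)})"
      using q by (intro card_mono) auto
    then have "real (card (B \<inter> real ` {1..N})) \<le> T * (r ^ (q+1) / (r - 1))"
      using sum[of "q+1"] by linarith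
    also have "\<dots> = T * (r / (r - 1)) * r ^ q" by simp
    also have "r ^ q = real (2 ^ q) powr a"
      unfolding r_def by (simp add: powr_powr powr_realpow[symmetric] mult.commute)
    also have "T * (r / (r - 1)) * real (2 ^ q) powr a \<le> T * (r / (r - 1)) * real N powr a"
      using q(1) T r \<open>a > 0\<close> by (intro mult_left_mono powr_mono2) (simp_all del: of_nat_power)
    finally show "real (card (B \<inter> real ` {1..N})) \<le> T * (r / (r - 1)) * real N powr a" .
  qed
qed

text \<open>The strict inequality lets the limsup be traded for a bound without a constant;
  \<open>l > 1\<close> keeps \<open>ln l\<close> positive.\<close>

lemma eventually_card_le_powr:
  assumes "mass_dim2 E < ereal d"
  shows "\<forall>\<^sub>F l in at_top. real (card (E \<inter> {0..l} \<times> {0..l})) \<le> l powr d"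
proof -
  have "\<forall>\<^sub>F l::real in at_top. log_card (E \<inter> {0..l} \<times> {0..l}) / ereal (ln l) < ereal d"
    using assms unfolding mass_dim2_def by (rule Limsup_lessD)
  then show ?thesis using eventually_gt_at_top[of 1]
  proof eventually_elim
    case (elim l)
    let ?n = "card (E \<inter> {0..l} \<times> {0..l})"
    show ?case
    proof (cases "?n = 0")
      case False
      then have "ln (real ?n) < d * ln l"
        using elim by (simp add: log_card_def field_simps)
      then have "real ?n < exp (d * ln l)"
        using False by (metis exp_less_mono exp_ln of_nat_0_less_iff gr0I)
      then show ?thesis using elim by (simp add: powr_def)
    qed simp
  qed
qed

text \<open>\<open>card\<close> is monotone only into finite sets, and it sends infinite sets to 0;
  this makes the later counts meaningful.\<close>

lemma finite_Nats_square:
  assumes "E \<subseteq> \<nat> \<times> \<nat>"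
  shows "finite (E \<inter> {0..l::real} \<times> {0..l})"
proof -
  have "E \<inter> {0..l} \<times> {0..l} \<subseteq> (real ` {..nat \<lfloor>l\<rfloor>}) \<times> (real ` {..nat \<lfloor>l\<rfloor>})"
    using assms by (force simp: Nats_def le_nat_floor)
  then show ?thesis by (rule finite_subset) auto
qed

section \<open>Area of parameter strips\<close>

text \<open>For integer \<open>y\<close> the two conditions on \<open>u * x + v\<close> say that its
  floor is \<open>y\<close>. Cutting \<open>v\<close> off at \<open>m\<close> makes the area finite
  for \<open>x > 0\<close>.\<close>

definition strip :: "real \<Rightarrow> real \<Rightarrow> real \<Rightarrow> (real \<times> real) set" where
  "strip m x y = {(u, v). 0 \<le> v \<and> v \<le> m \<and> y \<le> u * x + v \<and> u * x + v < y + 1}"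

lemma strip_measurable [measurable]: "strip m x y \<in> sets borel"
proof -
  have "strip m x y = {p. 0 \<le> snd p \<and> snd p \<le> m \<and> y \<le> fst p * x + snd p \<and> fst p * x + snd p < y + 1}"
    by (auto simp: strip_def)
  also have "\<dots> = {p \<in> space (borel \<Otimes>\<^sub>M borel). 0 \<le> snd p \<and> snd p \<le> m \<and> y \<le> fst p * x + snd p \<and> fst p * x + snd p < y + 1}"
    by (simp add: space_pair_measure)
  also have "\<dots> \<in> sets (borel \<Otimes>\<^sub>M borel)" by measurable
  finally show ?thesis by (simp only: borel_prod)
qed

text \<open>By Tonelli: for each \<open>v\<close> in \<open>{0..m}\<close> the section in
  \<open>u\<close> lies in an interval of length \<open>1 / x\<close>.\<close>

lemma emeasure_strip_le:
  assumes "x > 0" "m \<ge> 0"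
  shows "emeasure lborel (strip m x y) \<le> ennreal (m / x)"
proof -
  have "strip m x y \<in> sets (lborel \<Otimes>\<^sub>M lborel)"
    by (simp only: lborel_prod sets_lborel strip_measurable)
  then have "emeasure lborel (strip m x y) =
      (\<integral>\<^sup>+v. emeasure lborel ((\<lambda>u. (u, v)) -` strip m x y) \<partial>lborel)"
    by (simp add: lborel_pair.emeasure_pair_measure_alt2 flip: lborel_prod)
  also have "\<dots> \<le> (\<integral>\<^sup>+v. ennreal (1 / x) * indicator {0..m} v \<partial>lborel)"
  proof (rule nn_integral_mono)
    fix v
    have "(\<lambda>u. (u, v)) -` strip m x y \<subseteq> (if v \<in> {0..m} then {(y - v) / x..(y + 1 - v) / x} else {})"
      using \<open>x > 0\<close> by (auto simp: strip_def field_simps)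
    then have "emeasure lborel ((\<lambda>u. (u, v)) -` strip m x y) \<le>
        emeasure lborel (if v \<in> {0..m} then {(y - v) / x..(y + 1 - v) / x} else {})"
      by (intro emeasure_mono) auto
    also have "\<dots> \<le> ennreal (1 / x) * indicator {0..m} v"
      using \<open>x > 0\<close> by (auto simp: divide_right_mono diff_divide_distrib[symmetric])
    finally show "emeasure lborel ((\<lambda>u. (u, v)) -` strip m x y) \<le> ennreal (1 / x) * indicator {0..m} v" .
  qed
  also have "\<dots> = ennreal (m / x)"
    using assms by (simp add: nn_integral_cmult_indicator ennreal_mult[symmetric])
  finally show ?thesis .
qed

section \<open>Almost every slice has small dimension\<close>

lemma AE_mass_dim1_slice_le:
  assumes E: "E \<subseteq> \<nat> \<times> \<nat>" and dim: "mass_dim2 E < ereal (1 + a)" and "a > 0" and m: "m \<ge> 1"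
  shows "AE w in lborel. fst w \<in> {1/m..m} \<and> snd w \<in> {0..m} \<longrightarrow>
           mass_dim1 (line_slice E (fst w) (snd w)) \<le> ereal a"
proof -
  \<comment> \<open>Points are counted with exponent \<open>d\<close>; the gap between
    \<open>d\<close> and \<open>1 + a\<close> makes \<open>q < 1\<close>. In the exponent of
    \<open>q\<close>, \<open>d\<close> comes from the count, \<open>- 1\<close> from the strip area
    and \<open>- a\<close> from the weight.\<close>
  obtain d where d: "mass_dim2 E < ereal d" "d < 1 + a"
    using ereal_dense2[OF dim] by auto
  define r :: real where "r = 2 powr a"
  define q :: real where "q = 2 powr (d - 1 - a)"
  define A where "A = (4 * m) powr d * (2 * m\<^sup>2)"
  have r: "r > 0" by (simp add: r_def)
  have q: "q > 0" "q < 1" using d by (simp_all add: q_def powr_less_one)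
  define L where "L k = 4 * m * 2 ^ k" for k :: nat
  \<comment> \<open>Candidates chosen independently of \<open>(u, v)\<close>: for large
    \<open>k\<close> they include every point in block \<open>k\<close> met by a line with
    parameters in the box. \<open>L k\<close> is the side of a square containing them.\<close>
  define P where "P k = E \<inter> {(x, y). 2^k \<le> y \<and> y < 2^(k+1) \<and> y \<le> 2 * m * x \<and> x \<le> m * (y + 1)}" for k :: nat
  have P_sub: "P k \<subseteq> E \<inter> {0..L k} \<times> {0..L k}" for k
  proof
    fix p assume p: "p \<in> P k"
    obtain x y where xy: "p = (x, y)" by force
    have *: "0 \<le> x" "0 \<le> y" "y < 2^(k+1)" "x \<le> m * (y + 1)" "p \<in> E"
      using p E by (auto simp: P_def xy elim!: Nats_cases)
    have "(1::real) \<le> 2^k" by simp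
    then have y: "y + 1 \<le> 4 * 2^k" using *(3) by (simp only: power_add power_one_right)
    have "m * (y + 1) \<le> m * (4 * 2^k)" using y m by (intro mult_left_mono) auto
    moreover have "1 * (4 * 2^k) \<le> m * (4 * 2^k)" using m by (intro mult_right_mono) auto
    ultimately have "x \<le> 4 * m * 2 ^ k" "y \<le> 4 * m * 2 ^ k"
      using *(4) y by linarith+
    then show "p \<in> E \<inter> {0..L k} \<times> {0..L k}"
      using * by (auto simp: L_def xy)
  qed
  have fin: "finite (P k)" for k
    using finite_subset[OF P_sub] finite_Nats_square[OF E] by blast
  have "filterlim (\<lambda>k. 2 ^ k :: real) at_top sequentially"
    by (rule filterlim_at_infinity_imp_filterlim_at_top[OF filterlim_realpow_sequentially_gt1]) auto
  then have pow: "filterlim (\<lambda>k. c * 2 ^ k :: real) at_top sequentially" if "c > 0" for c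
    using that by (intro filterlim_tendsto_pos_mult_at_top[OF tendsto_const])
  have "\<forall>\<^sub>F k in sequentially. real (card (E \<inter> {0..L k} \<times> {0..L k})) \<le> L k powr d"
    unfolding L_def
    by (rule eventually_compose_filterlim[OF eventually_card_le_powr[OF d(1)] pow]) (use m in auto)
  \<comment> \<open>This makes the offset \<open>v \<le> m\<close> at most half of \<open>y\<close>,
    which is what yields \<open>y \<le> 2 * m * x\<close>.\<close>
  moreover have "\<forall>\<^sub>F k in sequentially. 2 * m \<le> 2 ^ k"
    using pow[of 1] unfolding filterlim_at_top by simp
  ultimately have "\<forall>\<^sub>F k in sequentially.
      real (card (E \<inter> {0..L k} \<times> {0..L k})) \<le> L k powr d \<and> 2 * m \<le> 2 ^ k"
    by (rule eventually_conj)
  then obtain K where K: "\<And>k. k \<ge> K \<Longrightarrow> real (card (E \<inter> {0..L k} \<times> {0..L k})) \<le> L k powr d"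
      "\<And>k. k \<ge> K \<Longrightarrow> 2 * m \<le> 2 ^ k"
    unfolding eventually_sequentially by blast
  \<comment> \<open>The number of candidates in block \<open>k\<close> whose strip contains
    \<open>w\<close>, with weight \<open>2 powr (- a * k)\<close>.\<close>
  define f :: "nat \<Rightarrow> real \<times> real \<Rightarrow> ennreal" where
    "f k w = ennreal (1 / r^k) * (\<Sum>p\<in>P k. indicator (strip m (fst p) (snd p)) w)" for k w
  have f_meas [measurable]: "f k \<in> borel_measurable lborel" for k
    unfolding f_def by measurable
  have f_int: "(\<integral>\<^sup>+w. f k w \<partial>lborel) \<le> ennreal (A * q ^ k)" if k: "k \<ge> K" for k
  proof -
    have "(\<integral>\<^sup>+w. f k w \<partial>lborel) = ennreal (1 / r^k) * (\<Sum>p\<in>P k. emeasure lborel (strip m (fst p) (snd p)))"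
      unfolding f_def by (simp add: nn_integral_cmult nn_integral_sum)
    also have "\<dots> \<le> ennreal (1 / r^k) * (\<Sum>p\<in>P k. ennreal (2 * m\<^sup>2 / 2^k))"
    proof (intro mult_left_mono sum_mono)
      fix p assume p: "p \<in> P k"
      obtain x y where xy: "p = (x, y)" by force
      have *: "2^k \<le> y" "y \<le> 2 * m * x" using p by (auto simp: P_def xy)
      have x: "2^k \<le> 2 * m * x" using * by simp
      then have "x > 0" using m zero_less_power[of "2::real" k]
        by (smt (verit) mult_nonneg_nonpos)
      have "emeasure lborel (strip m x y) \<le> ennreal (m / x)"
        using \<open>x > 0\<close> m by (intro emeasure_strip_le) auto
      also have "m / x \<le> 2 * m\<^sup>2 / 2^k"
        using mult_left_mono[OF x, of m] m \<open>x > 0\<close> by (simp add: field_simps power2_eq_square)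
      finally show "emeasure lborel (strip m (fst p) (snd p)) \<le> ennreal (2 * m\<^sup>2 / 2^k)"
        by (simp add: xy ennreal_leI)
    qed auto
    also have "\<dots> = ennreal (1 / r^k * (real (card (P k)) * (2 * m\<^sup>2 / 2^k)))"
      using r by (simp add: ennreal_mult ennreal_of_nat_eq_real_of_nat
          del: times_divide_eq_left times_divide_eq_right times_divide_times_eq)
    also have "\<dots> \<le> ennreal (1 / r^k * (L k powr d * (2 * m\<^sup>2 / 2^k)))"
    proof (intro ennreal_leI mult_left_mono mult_right_mono)
      have "card (P k) \<le> card (E \<inter> {0..L k} \<times> {0..L k})"
        by (intro card_mono P_sub finite_Nats_square E)
      then show "real (card (P k)) \<le> L k powr d" using K(1)[OF k] by linarith
    qed (use r in auto)
    also have "1 / r^k * (L k powr d * (2 * m\<^sup>2 / 2^k)) = A * q ^ k"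
    proof -
      have "L k powr d = (4 * m) powr d * (2 powr d) ^ k"
        unfolding L_def using m by (simp add: powr_mult powr_powr powr_realpow[symmetric] mult.commute)
      moreover have "q = 2 powr d / 2 / r"
        by (simp add: q_def r_def powr_diff)
      ultimately show ?thesis
        by (simp add: A_def power_divide power_mult_distrib mult_ac)
    qed
    finally show ?thesis .
  qed
  \<comment> \<open>The index is shifted because the bound on the integrals starts at
    \<open>K\<close>; the shifted series is dominated by a geometric one.\<close>
  have "(\<integral>\<^sup>+w. (\<Sum>k. f (k + K) w) \<partial>lborel) = (\<Sum>k. \<integral>\<^sup>+w. f (k + K) w \<partial>lborel)"
    by (intro nn_integral_suminf) auto
  also have "\<dots> \<le> (\<Sum>k. ennreal (A * q ^ (k + K)))"
    by (intro suminf_le f_int) auto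
  also have "\<dots> < \<infinity>"
    unfolding infinity_ennreal_def less_top[symmetric] using q m
    by (intro ennreal_suminf_neq_top summable_mult summable_ignore_initial_segment summable_geometric) (auto simp: A_def)
  finally have "AE w in lborel. (\<Sum>k. f (k + K) w) \<noteq> \<infinity>"
    by (intro nn_integral_PInf_AE) auto
  then show ?thesis
  proof (rule AE_mp, intro AE_I2 impI, elim conjE)
    fix w :: "real \<times> real"
    assume fin_sum: "(\<Sum>k. f (k + K) w) \<noteq> \<infinity>" and w: "fst w \<in> {1/m..m}" "snd w \<in> {0..m}"
    obtain u v where uv: "w = (u, v)" by force
    \<comment> \<open>Each weighted block count is at most the whole sum, so \<open>S\<close>, which
      depends on \<open>w\<close>, serves as the constant in the dyadic criterion.\<close>
    define S where "S = enn2real (\<Sum>k. f (k + K) w)"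
    have S: "S \<ge> 0" "(\<Sum>k. f (k + K) w) = ennreal S"
      using fin_sum by (simp_all add: S_def less_top)
    show "mass_dim1 (line_slice E (fst w) (snd w)) \<le> ereal a"
    proof (rule mass_dim1_le_dyadic[OF \<open>a > 0\<close>])
      fix k assume k: "k \<ge> K"
      let ?Q = "{p \<in> P k. w \<in> strip m (fst p) (snd p)}"
      \<comment> \<open>Several points of \<open>?Q\<close> may share a \<open>y\<close>; projecting
        can only lower the count.\<close>
      have "line_slice E u v \<inter> real ` {2^k..<2^(k+1)} \<subseteq> snd ` ?Q"
      proof
        fix y assume y: "y \<in> line_slice E u v \<inter> real ` {2^k..<2^(k+1)}"
        then obtain x n where x: "(x, y) \<in> E" "y = real_of_int \<lfloor>u * x + v\<rfloor>"
          and n: "y = real n" "2^k \<le> n" "n < 2^(k+1)"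
          by (auto simp: line_slice_def)
        have y2: "2^k \<le> y" "y < 2^(k+1)"
          using n(2,3) unfolding n(1) by (metis of_nat_le_iff of_nat_less_iff of_nat_numeral of_nat_power)+
        have fl: "y \<le> u * x + v" "u * x + v < y + 1" using x(2) by linarith+
        have "x \<ge> 0" using x(1) E by (auto elim!: Nats_cases)
        have "u * x \<le> m * x" using w \<open>x \<ge> 0\<close> by (intro mult_right_mono) (auto simp: uv)
        then have "y \<le> 2 * m * x" using fl(1) K(2)[OF k] y2(1) w by (simp add: uv)
        moreover have "x \<le> m * (y + 1)"
        proof -
          have "1 / m * x \<le> u * x" using w \<open>x \<ge> 0\<close> by (intro mult_right_mono) (auto simp: uv)
          then have "1 / m * x \<le> y + 1" using fl(2) w by (simp add: uv)
          then show ?thesis using m by (simp add: field_simps)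
        qed
        ultimately have "(x, y) \<in> ?Q"
          using x(1) y2 fl w by (auto simp: P_def strip_def uv)
        then show "y \<in> snd ` ?Q" by force
      qed
      then have "card (line_slice E u v \<inter> real ` {2^k..<2^(k+1)}) \<le> card ?Q"
        by (rule surj_card_le[rotated]) (use fin in auto)
      moreover have "real (card ?Q) \<le> S * r ^ k"
      proof -
        have "(\<Sum>p\<in>P k. indicator (strip m (fst p) (snd p)) w) = (of_nat (card ?Q) :: ennreal)"
          by (simp add: indicator_def of_bool_def sum.If_cases[OF fin] Int_def)
        then have "f k w = ennreal (1 / r^k * real (card ?Q))"
          using r by (simp add: f_def ennreal_mult'[symmetric] ennreal_of_nat_eq_real_of_nat)
        moreover have "f k w \<le> (\<Sum>k. f (k + K) w)"
          using sum_le_suminf[of "\<lambda>k. f (k + K) w" "{k - K}"] k by simp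
        ultimately have "1 / r^k * real (card ?Q) \<le> S"
          using S by (simp add: ennreal_le_iff)
        then show ?thesis using r by (simp add: field_simps)
      qed
      ultimately show "real (card (line_slice E (fst w) (snd w) \<inter> real ` {2^k..<2^(k+1)})) \<le> S * (2 powr a) ^ k"
        by (simp add: uv r_def)
    qed
  qed
qed

text \<open>Countably many null sets are discarded: one for each box, the boxes exhausting the open
  quadrant, and each excess \<open>inverse (Suc n)\<close>, which tends to 0.\<close>

lemma AE_mass_dim1_slice:
  assumes E: "E \<subseteq> \<nat> \<times> \<nat>"
  shows "AE (u, v) in lborel. 0 < u \<and> 0 < v \<longrightarrow>
           mass_dim1 (line_slice E u v) \<le> max 0 (mass_dim2 E - 1)"
proof (cases "mass_dim2 E = \<infinity>")
  case True
  then show ?thesis by (simp add: max_def)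
next
  case False
  \<comment> \<open>The maximum with 0 keeps this value finite even if \<open>mass_dim2 E\<close> is
    minus infinity.\<close>
  define b where "b = real_of_ereal (max 0 (mass_dim2 E - 1))"
  have b: "ereal b = max 0 (mass_dim2 E - 1)" "b \<ge> 0"
    using False unfolding b_def
    by (cases "mass_dim2 E"; auto simp: max_def zero_ereal_def one_ereal_def)+
  have b': "mass_dim2 E < ereal (1 + (b + inverse (Suc n)))" for n
  proof -
    have "mass_dim2 E \<le> ereal (1 + b)"
      using b(1) False
      by (cases "mass_dim2 E") (auto simp: max_def zero_ereal_def one_ereal_def split: if_splits)
    also have "\<dots> < ereal (1 + (b + inverse (Suc n)))" by simp
    finally show ?thesis .
  qed
  have "AE w in lborel. \<forall>n m. fst w \<in> {1/real (Suc m)..real (Suc m)} \<and> snd w \<in> {0..real (Suc m)} \<longrightarrow>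
           mass_dim1 (line_slice E (fst w) (snd w)) \<le> ereal (b + inverse (Suc n))"
    unfolding AE_all_countable
    by (intro allI AE_mass_dim1_slice_le E b') (use b(2) in \<open>auto intro: add_nonneg_pos\<close>)
  then show ?thesis
  proof (rule AE_mp, intro AE_I2 impI, clarify)
    fix u v :: real
    assume *: "\<forall>n m. fst (u, v) \<in> {1/real (Suc m)..real (Suc m)} \<and> snd (u, v) \<in> {0..real (Suc m)} \<longrightarrow>
           mass_dim1 (line_slice E (fst (u, v)) (snd (u, v))) \<le> ereal (b + inverse (Suc n))"
      and "0 < u" "0 < v"
    \<comment> \<open>The term \<open>1 / u\<close> is included because the boxes also bound
      \<open>u\<close> away from 0.\<close>
    obtain m where m: "max u (max v (1 / u)) \<le> real m" using real_arch_simple by blast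
    have "1 / u \<le> real (Suc m)" using m by simp
    then have "u \<in> {1/real (Suc m)..real (Suc m)}" "v \<in> {0..real (Suc m)}"
      using m \<open>0 < u\<close> \<open>0 < v\<close> by (auto simp: field_simps)
    then have le: "mass_dim1 (line_slice E u v) \<le> ereal (b + inverse (Suc n))" for n
      using *[rule_format, of m n] by (metis fst_conv snd_conv)
    have "(\<lambda>n. ereal (b + inverse (Suc n))) \<longlonglongrightarrow> ereal (b + 0)"
      by (intro tendsto_intros LIMSEQ_inverse_real_of_nat)
    then show "mass_dim1 (line_slice E u v) \<le> max 0 (mass_dim2 E - 1)"
      using le b(1) by (auto intro: LIMSEQ_le_const)
  qed
qed

section \<open>From almost everywhere to density\<close>

theorem theorem1p5:
  fixes E :: "(real \<times> real) set"
  assumes "E \<subseteq> \<nat> \<times> \<nat>"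
  shows "((\<lambda>M::real.
      measure lebesgue
        ({(u, v). u > 0 \<and> v > 0 \<and>
            mass_dim1 (line_slice E u v) \<le> max 0 (mass_dim2 E - 1)}
          \<inter> {0..M} \<times> {0..M}) / M\<^sup>2) \<longlongrightarrow> 1) at_top"
proof -
  define U where "U = {(u, v). u > 0 \<and> v > 0 \<and>
            mass_dim1 (line_slice E u v) \<le> max 0 (mass_dim2 E - 1)}"
  \<comment> \<open>The squares \<open>{0..M} \<times> {0..M}\<close> contain parts of the axes,
    where \<open>U\<close> has no points; the axes are null.\<close>
  have "{0::real} \<times> (UNIV::real set) \<in> null_sets lborel" "(UNIV::real set) \<times> {0::real} \<in> null_sets lborel"
    by (simp_all add: null_sets_def lborel.emeasure_pair_measure_Times borel_prod[symmetric] flip: lborel_prod)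
  then have "AE w in lborel. w \<notin> {0::real} \<times> (UNIV::real set) \<and> w \<notin> (UNIV::real set) \<times> {0::real}"
    by (intro AE_conjI AE_not_in)
  with AE_mass_dim1_slice[OF assms]
  have "AE w in lborel. fst w \<ge> 0 \<and> snd w \<ge> 0 \<longrightarrow> w \<in> U"
    by eventually_elim (auto simp: U_def)
  then obtain N where N: "{w. \<not> (fst w \<ge> 0 \<and> snd w \<ge> 0 \<longrightarrow> w \<in> U)} \<subseteq> N" "N \<in> null_sets lborel"
    by (auto simp: eventually_ae_filter)
  \<comment> \<open>The ratio is exactly 1 for each \<open>M > 0\<close>. Completeness of
    \<open>lebesgue\<close> makes \<open>?B - U\<close>, a subset of the null set \<open>N\<close>,
    measurable and null, which avoids proving directly that \<open>U\<close> is measurable.\<close>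
  have "measure lebesgue (U \<inter> {0..M} \<times> {0..M}) = M\<^sup>2" if "M > 0" for M
  proof -
    let ?B = "{0..M} \<times> {0..M}"
    have "?B - U \<in> null_sets lebesgue"
      using N by (intro null_sets_completion_subset[OF _ N(2)[THEN null_sets_completionI]]) auto
    then have "measure lebesgue (?B - (?B - U)) = measure lebesgue ?B"
      by (intro measure_Diff_null_set) (simp_all add: cbox_Pair_eq[symmetric] box_real(2)[symmetric] del: box_real(2))
    also have "?B - (?B - U) = U \<inter> ?B" by auto
    also have "?B = cbox (0, 0) (M, M)" by (simp add: cbox_Pair_eq)
    also have "measure lebesgue \<dots> = M\<^sup>2"
      using that by (simp add: measure_lborel_cbox_eq Basis_prod_def power2_eq_square)
    finally show ?thesis by (simp add: cbox_Pair_eq)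
  qed
  then have "\<forall>\<^sub>F M in at_top. measure lebesgue (U \<inter> {0..M} \<times> {0..M}) / M\<^sup>2 = 1"
    by (intro eventually_mono[OF eventually_gt_at_top[of 0]]) simp
  then show ?thesis
    unfolding U_def by (rule tendsto_eventually)
qed

end
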